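(* Let $G$ be a simple graph with vertex set $V$, and let $G^\sigma$ be an oriented graph of $G$ with skew adjacency matrix $S(G^\sigma)$ and skew spectral radius $\rho_s(G^\sigma)$. Then for any two nonempty subsets $A,B\subseteq V$ (not necessarily disjoint), $$\rho_s(G^\sigma)\geq\frac{|\gamma(A,B)-\gamma(B,A)|}{\sqrt{|A|\,|B|}}.$$
   Context: An oriented graph $G^\sigma$ of a simple graph $G$ on vertices $v_1,\dots,v_n$ is obtained by giving each edge of $G$ one of its two directions; $G$ is its underlying graph. Its skew adjacency matrix $S(G^\sigma)=(s_{ij})$ is the $n\times n$ matrix with $s_{ij}=1$ and $s_{ji}=-1$ if $\langle v_i,v_j\rangle$ is an arc (tail $v_i$, head $v_j$), and $s_{ij}=s_{ji}=0$ otherwise. The skew spectral radius $\rho_s(G^\sigma)$ is the spectral radius (maximum modulus of an eigenvalue) of $S(G^\sigma)$. For subsets $A,B\subseteq V$, $\gamma(A,B)$ denotes the number of arcs whose tail lies in $A$ and whose head lies in $B$. *)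

theory Defs
  imports
    Complex_Main
    "Graph_Theory.Pair_Digraph"
    "Jordan_Normal_Form.Spectral_Radius"
begin

text \<open>
  A finite simple graph is a \<open>pair_graph\<close>: a finite loop-free digraph with a symmetric arc
  relation, in which an edge \<open>{u, v}\<close> is the pair of arcs \<open>(u, v)\<close>, \<open>(v, u)\<close>.
  An orientation keeps exactly one arc of each such pair.
\<close>

definition orientation_of :: "'a pair_pre_digraph \<Rightarrow> 'a pair_pre_digraph \<Rightarrow> bool" where
  "orientation_of D G \<longleftrightarrow>
     pverts D = pverts G \<and> parcs D \<subseteq> parcs G \<and>
     (\<forall>u v. (u, v) \<in> parcs G \<longrightarrow> ((u, v) \<in> parcs D) \<noteq> ((v, u) \<in> parcs D))"

text \<open>
  The list \<open>vs\<close> is the vertex labelling; matrix indices start at 0. The entries are complex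
  because \<open>spectral_radius\<close> is the maximum modulus of the complex eigenvalues.
\<close>

definition skew_adjacency_matrix :: "'a list \<Rightarrow> 'a pair_pre_digraph \<Rightarrow> complex mat" where
  "skew_adjacency_matrix vs D = mat (length vs) (length vs)
     (\<lambda>(i, j). if (vs ! i, vs ! j) \<in> parcs D then 1
               else if (vs ! j, vs ! i) \<in> parcs D then - 1
               else 0)"

definition skew_spectral_radius :: "'a list \<Rightarrow> 'a pair_pre_digraph \<Rightarrow> real" where
  "skew_spectral_radius vs D = spectral_radius (skew_adjacency_matrix vs D)"

definition arcs_between :: "'a pair_pre_digraph \<Rightarrow> 'a set \<Rightarrow> 'a set \<Rightarrow> nat" where
  "arcs_between D A B = card {e \<in> parcs D. fst e \<in> A \<and> snd e \<in> B}"

end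

theory Submission
  imports Defs "HOL-Analysis.L2_Norm"
begin

text \<open>
  A normal matrix \<open>S\<close> satisfies \<open>\<parallel>S v\<parallel>\<^sup>2 \<le> \<parallel>S (S v)\<parallel> \<parallel>v\<parallel>\<close>, so the norms of
  \<open>v, S v, S\<^sup>2 v, \<dots>\<close> grow at least geometrically with ratio \<open>\<parallel>S v\<parallel> / \<parallel>v\<parallel>\<close>.
  Since the powers of \<open>S / c\<close> are bounded for every \<open>c > \<rho>(S)\<close>, this ratio is at most \<open>\<rho>(S)\<close>.
  The theorem is the resulting bound \<open>\<bar>\<langle>S b, a\<rangle>\<bar> \<le> \<rho>(S) \<parallel>a\<parallel> \<parallel>b\<parallel>\<close> for the
  indicator vectors \<open>a\<close> and \<open>b\<close> of \<open>A\<close> and \<open>B\<close>.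
\<close>

section \<open>The Euclidean norm of a complex vector\<close>

text \<open>Going through \<open>L2_set\<close> of the moduli makes the real inequalities for
  \<open>L2_set\<close> available for complex vectors.\<close>

definition vec_norm2 :: "complex vec \<Rightarrow> real" where
  "vec_norm2 v = L2_set (\<lambda>i. cmod (v $ i)) {..<dim_vec v}"

lemma vec_norm2_nonneg [simp]: "0 \<le> vec_norm2 v"
  by (simp add: vec_norm2_def)

lemma vec_norm2_zero [simp]: "vec_norm2 (0\<^sub>v n) = 0"
  by (simp add: vec_norm2_def L2_set_0')

lemma vec_norm2_eq_0_iff: "v \<in> carrier_vec n \<Longrightarrow> vec_norm2 v = 0 \<longleftrightarrow> v = 0\<^sub>v n"
  by (auto simp: vec_norm2_def L2_set_eq_0_iff intro!: eq_vecI)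

lemma vec_norm2_smult [simp]: "vec_norm2 (c \<cdot>\<^sub>v v) = cmod c * vec_norm2 v"
proof -
  have "vec_norm2 (c \<cdot>\<^sub>v v) = L2_set (\<lambda>i. cmod c * cmod (v $ i)) {..<dim_vec v}"
    unfolding vec_norm2_def by (intro L2_set_cong) (auto simp: norm_mult)
  thus ?thesis by (simp add: vec_norm2_def L2_set_right_distrib)
qed

lemma cscalar_prod_self: "v \<bullet>c v = complex_of_real ((vec_norm2 v)\<^sup>2)"
proof -
  have "(vec_norm2 v)\<^sup>2 = (\<Sum>i<dim_vec v. (cmod (v $ i))\<^sup>2)"
    by (simp add: vec_norm2_def L2_set_def sum_nonneg)
  thus ?thesis
    by (simp add: scalar_prod_def complex_norm_square atLeast0LessThan del: of_real_power)
qed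

text \<open>Cauchy-Schwarz: the triangle inequality reduces it to the real version for the sequences
  of moduli.\<close>

lemma cmod_cscalar_prod_le:
  assumes "dim_vec v = dim_vec w"
  shows "cmod (v \<bullet>c w) \<le> vec_norm2 v * vec_norm2 w"
proof -
  have "cmod (v \<bullet>c w) \<le> (\<Sum>i<dim_vec v. \<bar>cmod (v $ i)\<bar> * \<bar>cmod (w $ i)\<bar>)"
    unfolding scalar_prod_def atLeast0LessThan using assms
    by (intro order_trans[OF norm_sum] eq_refl sum.cong) (auto simp: norm_mult)
  also have "\<dots> \<le> vec_norm2 v * vec_norm2 w"
    using L2_set_mult_ineq[of "\<lambda>i. cmod (v $ i)" "\<lambda>i. cmod (w $ i)" "{..<dim_vec v}"] assms
    by (simp add: vec_norm2_def)
  finally show ?thesis .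
qed

lemma vec_norm2_indicator:
  "vec_norm2 (vec n (\<lambda>i. of_bool (P i))) = sqrt (card {i. i < n \<and> P i})"
proof -
  have "(\<Sum>i<n. (cmod (vec n (\<lambda>i. of_bool (P i)) $ i))\<^sup>2) = (\<Sum>i<n. of_bool (P i))"
    by (intro sum.cong) auto
  also have "\<dots> = real (card {i. i < n \<and> P i})"
    by (simp add: sum_of_bool_eq lessThan_def Collect_conj_eq)
  finally show ?thesis by (simp add: vec_norm2_def L2_set_def)
qed

section \<open>Normal matrices\<close>

lemma mat_adjoint_index:
  fixes A :: "complex mat"
  assumes "A \<in> carrier_mat n n" "i < n" "j < n"
  shows "mat_adjoint A $$ (i, j) = cnj (A $$ (j, i))"
  using assms by (simp add: mat_adjoint_def mat_of_rows_def)

lemma dim_mat_adjoint [simp]: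
  "dim_row (mat_adjoint A) = dim_col A" "dim_col (mat_adjoint A) = dim_row A"
  by (simp_all add: mat_adjoint_def)

lemma mat_adjoint_carrier: "A \<in> carrier_mat n n \<Longrightarrow> mat_adjoint A \<in> carrier_mat n n"
  by auto

lemma mult_mat_vec_index:
  assumes "A \<in> carrier_mat n n" "v \<in> carrier_vec n" "i < n"
  shows "(A *\<^sub>v v) $ i = (\<Sum>j<n. A $$ (i, j) * v $ j)"
  using assms by (auto simp: scalar_prod_def atLeast0LessThan intro!: sum.cong)

text \<open>Both sides are the same double sum over \<open>i\<close> and \<open>j\<close>, summed in
  opposite orders.\<close>

lemma cscalar_prod_mat_adjoint:
  fixes A :: "complex mat"
  assumes A: "A \<in> carrier_mat n n" and v: "v \<in> carrier_vec n" and w: "w \<in> carrier_vec n"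
  shows "(A *\<^sub>v v) \<bullet>c w = v \<bullet>c (mat_adjoint A *\<^sub>v w)"
proof -
  have A': "mat_adjoint A \<in> carrier_mat n n" using A by (rule mat_adjoint_carrier)
  have "(A *\<^sub>v v) \<bullet>c w = (\<Sum>i<n. (A *\<^sub>v v) $ i * cnj (w $ i))"
    using A w by (simp add: scalar_prod_def atLeast0LessThan del: index_mult_mat_vec)
  also have "\<dots> = (\<Sum>i<n. \<Sum>j<n. A $$ (i, j) * v $ j * cnj (w $ i))"
    by (intro sum.cong refl) (simp add: mult_mat_vec_index[OF A v] sum_distrib_right del: index_mult_mat_vec)
  also have "\<dots> = (\<Sum>j<n. \<Sum>i<n. A $$ (i, j) * v $ j * cnj (w $ i))"
    by (rule sum.swap)
  also have "\<dots> = (\<Sum>j<n. v $ j * cnj ((mat_adjoint A *\<^sub>v w) $ j))"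
    by (intro sum.cong refl)
      (auto simp: mult_mat_vec_index[OF A' w] mat_adjoint_index[OF A] sum_distrib_left mult_ac
        simp del: index_mult_mat_vec intro!: sum.cong)
  also have "\<dots> = v \<bullet>c (mat_adjoint A *\<^sub>v w)"
    using A by (simp add: scalar_prod_def atLeast0LessThan del: index_mult_mat_vec)
  finally show ?thesis .
qed

lemma mat_adjoint_mat_adjoint:
  fixes A :: "complex mat"
  assumes "A \<in> carrier_mat n n"
  shows "mat_adjoint (mat_adjoint A) = A"
  using assms
  by (intro eq_matI) (auto simp: mat_adjoint_index[of _ n] mat_adjoint_carrier)

text \<open>The two squared norms are the inner products of \<open>v\<close> with
  \<open>(A * mat_adjoint A) *\<^sub>v v\<close> and with
  \<open>(mat_adjoint A * A) *\<^sub>v v\<close>, which agree by normality.\<close>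

lemma normal_vec_norm2_adjoint:
  assumes A: "A \<in> carrier_mat n n" and normal: "mat_adjoint A * A = A * mat_adjoint A"
    and v: "v \<in> carrier_vec n"
  shows "vec_norm2 (mat_adjoint A *\<^sub>v v) = vec_norm2 (A *\<^sub>v v)"
proof -
  let ?B = "mat_adjoint A"
  have B: "?B \<in> carrier_mat n n" using A by (rule mat_adjoint_carrier)
  have "(?B *\<^sub>v v) \<bullet>c (?B *\<^sub>v v) = v \<bullet>c ((A * ?B) *\<^sub>v v)"
    using cscalar_prod_mat_adjoint[OF B v, of "?B *\<^sub>v v"] A B v
    by (simp add: mat_adjoint_mat_adjoint)
  also have "\<dots> = (A *\<^sub>v v) \<bullet>c (A *\<^sub>v v)"
    using cscalar_prod_mat_adjoint[OF A v, of "A *\<^sub>v v"] A B v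
    by (simp flip: normal)
  finally have "(vec_norm2 (?B *\<^sub>v v))\<^sup>2 = (vec_norm2 (A *\<^sub>v v))\<^sup>2"
    unfolding cscalar_prod_self of_real_eq_iff .
  thus ?thesis by simp
qed

text \<open>Moving one factor \<open>A\<close> across the inner product and applying Cauchy-Schwarz
  gives the bound with \<open>mat_adjoint A\<close> as the outer factor; normality lets
  \<open>A\<close> replace it without changing the norm.\<close>

lemma normal_vec_norm2_log_convex:
  assumes A: "A \<in> carrier_mat n n" and normal: "mat_adjoint A * A = A * mat_adjoint A"
    and v: "v \<in> carrier_vec n"
  shows "(vec_norm2 (A *\<^sub>v v))\<^sup>2 \<le> vec_norm2 v * vec_norm2 (A *\<^sub>v (A *\<^sub>v v))"
proof -
  have Av: "A *\<^sub>v v \<in> carrier_vec n" using A v by simp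
  have "(vec_norm2 (A *\<^sub>v v))\<^sup>2 = cmod ((A *\<^sub>v v) \<bullet>c (A *\<^sub>v v))"
    by (simp add: cscalar_prod_self norm_power)
  also have "\<dots> = cmod (v \<bullet>c (mat_adjoint A *\<^sub>v (A *\<^sub>v v)))"
    by (simp add: cscalar_prod_mat_adjoint[OF A v Av])
  also have "\<dots> \<le> vec_norm2 v * vec_norm2 (mat_adjoint A *\<^sub>v (A *\<^sub>v v))"
    using A v by (intro cmod_cscalar_prod_le) auto
  finally show ?thesis by (simp add: normal_vec_norm2_adjoint[OF A normal Av])
qed

section \<open>Growth of the powers of a normal matrix along a vector\<close>

lemma pow_mat_Suc_mult_vec:
  fixes A :: "'a :: comm_semiring_1 mat"
  assumes "A \<in> carrier_mat n n" "v \<in> carrier_vec n"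
  shows "(A ^\<^sub>m Suc k) *\<^sub>v v = A ^\<^sub>m k *\<^sub>v (A *\<^sub>v v)"
  using assms by (simp add: assoc_mult_mat_vec[OF pow_carrier_mat])

text \<open>A growth ratio of at least \<open>q\<close> from \<open>v\<close> to
  \<open>A *\<^sub>v v\<close> is inherited by the next pair of iterates. The induction therefore
  restarts at \<open>A *\<^sub>v v\<close>, which is why \<open>v\<close> is generalised.\<close>

lemma normal_vec_norm2_pow_ge:
  assumes A: "A \<in> carrier_mat n n" and normal: "mat_adjoint A * A = A * mat_adjoint A"
    and "v \<in> carrier_vec n" and "0 \<le> q" and "q * vec_norm2 v \<le> vec_norm2 (A *\<^sub>v v)"
  shows "q ^ k * vec_norm2 v \<le> vec_norm2 (A ^\<^sub>m k *\<^sub>v v)"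
  using assms(3-)
proof (induction k arbitrary: v)
  case 0
  thus ?case using A by simp
next
  case (Suc k)
  let ?w = "A *\<^sub>v v"
  have w: "?w \<in> carrier_vec n" using A Suc.prems by simp
  have step: "q * vec_norm2 ?w \<le> vec_norm2 (A *\<^sub>v ?w)"
  \<comment> \<open>Log-convexity gives the claim multiplied by \<open>vec_norm2 v\<close>; this
    factor can be cancelled only if positive, and otherwise both sides vanish.\<close>
  proof (cases "vec_norm2 v = 0")
    case True
    hence "v = 0\<^sub>v n" using Suc.prems by (simp add: vec_norm2_eq_0_iff)
    hence "?w = 0\<^sub>v n" using A by auto
    thus ?thesis by simp
  next
    case False
    hence pos: "0 < vec_norm2 v" using vec_norm2_nonneg[of v] by linarith
    have "vec_norm2 v * (q * vec_norm2 ?w) \<le> (vec_norm2 ?w)\<^sup>2"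
      using mult_right_mono[OF Suc.prems(3) vec_norm2_nonneg[of ?w]]
      by (simp add: power2_eq_square mult_ac)
    also have "\<dots> \<le> vec_norm2 v * vec_norm2 (A *\<^sub>v ?w)"
      by (rule normal_vec_norm2_log_convex[OF A normal Suc.prems(1)])
    finally show ?thesis using pos by simp
  qed
  have "q ^ Suc k * vec_norm2 v \<le> q ^ k * vec_norm2 ?w"
    using mult_left_mono[OF Suc.prems(3), of "q ^ k"] Suc.prems(2) by (simp add: mult_ac)
  also have "\<dots> \<le> vec_norm2 (A ^\<^sub>m k *\<^sub>v ?w)"
    by (rule Suc.IH[OF w Suc.prems(2) step])
  finally show ?case
    by (simp only: pow_mat_Suc_mult_vec[OF A Suc.prems(1)])
qed

section \<open>Comparison of the growth with the spectral radius\<close>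

text \<open>An eigenvalue \<open>k\<close> of the scaled matrix gives the eigenvalue
  \<open>c * k\<close> of \<open>A\<close>, so \<open>c * cmod k\<close> stays below
  \<open>c\<close>.\<close>

lemma spectral_radius_smult_less_1:
  assumes A: "A \<in> carrier_mat n n" and n: "0 < n" and c: "spectral_radius A < c" "0 < c"
  shows "spectral_radius (complex_of_real (1 / c) \<cdot>\<^sub>m A) < 1"
proof -
  let ?B = "complex_of_real (1 / c) \<cdot>\<^sub>m A"
  have B: "?B \<in> carrier_mat n n" using A by simp
  obtain k v where k: "spectral_radius ?B = cmod k" and v: "eigenvector ?B v k"
    using spectral_radius_mem_max(1)[OF B n] by (auto simp: spectrum_def eigenvalue_def)
  have v': "v \<in> carrier_vec n" "v \<noteq> 0\<^sub>v n" "?B *\<^sub>v v = k \<cdot>\<^sub>v v"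
    using v A by (auto simp: eigenvector_def)
  have "A *\<^sub>v v = of_real c \<cdot>\<^sub>v (?B *\<^sub>v v)"
    using A v'(1) c(2) by (intro eq_vecI) (auto simp: smult_scalar_prod_distrib[of _ n])
  hence "A *\<^sub>v v = (of_real c * k) \<cdot>\<^sub>v v"
    by (simp only: v'(3) smult_smult_assoc)
  hence "of_real c * k \<in> spectrum A"
    using v' A by (auto simp: spectrum_def eigenvalue_def eigenvector_def)
  hence "c * cmod k \<le> spectral_radius A"
    using spectral_radius_mem_max(2)[OF A n imageI, of "of_real c * k"] c(2)
    by (simp add: norm_mult)
  hence "c * cmod k < c * 1" using c by linarith
  thus ?thesis using c(2) k by (simp only: mult_less_cancel_left_pos)
qed

lemma pow_smult_mat_mult_vec:
  fixes A :: "'a :: field mat"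
  assumes A: "A \<in> carrier_mat n n" and "v \<in> carrier_vec n"
  shows "((c \<cdot>\<^sub>m A) ^\<^sub>m k) *\<^sub>v v = c ^ k \<cdot>\<^sub>v (A ^\<^sub>m k *\<^sub>v v)"
  using assms(2)
proof (induction k arbitrary: v)
  case 0
  thus ?case using A by simp
next
  case (Suc k)
  have Av: "A *\<^sub>v v \<in> carrier_vec n" using A Suc.prems by simp
  have cA: "c \<cdot>\<^sub>m A \<in> carrier_mat n n" using A by simp
  have eq: "(c \<cdot>\<^sub>m A) *\<^sub>v v = c \<cdot>\<^sub>v (A *\<^sub>v v)"
    using A Suc.prems by (intro eq_vecI) (auto simp: smult_scalar_prod_distrib[of _ n])
  show ?case
    unfolding pow_mat_Suc_mult_vec[OF A Suc.prems] pow_mat_Suc_mult_vec[OF cA Suc.prems] eq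
    using Av
    by (simp add: Suc.IH mult_mat_vec[OF pow_carrier_mat[OF A]] smult_smult_assoc mult_ac)
qed

text \<open>A crude estimate suffices: what matters is that the right-hand side depends on the
  matrix only through \<open>n\<close> and \<open>b\<close>, hence is uniform over powers sharing an
  entrywise bound.\<close>

lemma norm_bound_vec_norm2:
  assumes A: "A \<in> carrier_mat n n" and b: "norm_bound A b" and v: "v \<in> carrier_vec n"
  shows "vec_norm2 (A *\<^sub>v v) \<le> real n * (b * (\<Sum>j<n. cmod (v $ j)))"
proof -
  have "cmod ((A *\<^sub>v v) $ i) \<le> b * (\<Sum>j<n. cmod (v $ j))" if i: "i < n" for i
  proof -
    have "cmod ((A *\<^sub>v v) $ i) \<le> (\<Sum>j<n. cmod (A $$ (i, j) * v $ j))"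
      unfolding mult_mat_vec_index[OF A v i] by (rule norm_sum)
    also have "\<dots> \<le> (\<Sum>j<n. b * cmod (v $ j))"
      using b A i by (intro sum_mono) (auto simp: norm_mult norm_bound_def intro!: mult_right_mono)
    finally show ?thesis by (simp add: sum_distrib_left)
  qed
  hence "(\<Sum>i<n. cmod ((A *\<^sub>v v) $ i)) \<le> real n * (b * (\<Sum>j<n. cmod (v $ j)))"
    using sum_bounded_above[of "{..<n}" "\<lambda>i. cmod ((A *\<^sub>v v) $ i)"]
    by (simp del: index_mult_mat_vec)
  moreover have "vec_norm2 (A *\<^sub>v v) \<le> (\<Sum>i<n. cmod ((A *\<^sub>v v) $ i))"
    unfolding vec_norm2_def using A by (simp del: index_mult_mat_vec add: L2_set_le_sum)
  ultimately show ?thesis by linarith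
qed

theorem normal_vec_norm2_le_spectral_radius:
  assumes A: "A \<in> carrier_mat n n" and normal: "mat_adjoint A * A = A * mat_adjoint A"
    and v: "v \<in> carrier_vec n" and n: "0 < n"
  shows "vec_norm2 (A *\<^sub>v v) \<le> spectral_radius A * vec_norm2 v"
proof (cases "v = 0\<^sub>v n")
  case True
  hence "A *\<^sub>v v = 0\<^sub>v n" using A by auto
  thus ?thesis using True by simp
next
  case False
  hence pos: "0 < vec_norm2 v"
    using vec_norm2_eq_0_iff[OF v] vec_norm2_nonneg[of v] by linarith
  define q where "q = vec_norm2 (A *\<^sub>v v) / vec_norm2 v"
  have q: "q * vec_norm2 v = vec_norm2 (A *\<^sub>v v)" "0 \<le> q"
    using pos by (auto simp: q_def)
  have "q \<le> spectral_radius A"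
  proof (rule ccontr)
    assume "\<not> q \<le> spectral_radius A"
    \<comment> \<open>Lying above the spectral radius, \<open>c\<close> makes the powers of
      \<open>A / c\<close> bounded; lying below \<open>q\<close>, it makes
      \<open>(q / c) ^ k\<close> unbounded.\<close>
    then obtain c where c: "spectral_radius A < c" "c < q"
      using dense[of "spectral_radius A" q] by auto
    have "0 \<le> spectral_radius A"
      using spectral_radius_mem_max(1)[OF A n] by auto
    hence c0: "0 < c" using c by linarith
    let ?B = "complex_of_real (1 / c) \<cdot>\<^sub>m A"
    have B: "?B \<in> carrier_mat n n" using A by simp
    \<comment> \<open>By the Jordan normal form, a spectral radius below 1 gives one entrywise bound
      for all powers, so \<open>M\<close> below is independent of \<open>k\<close>.\<close>
    obtain b where b: "\<And>k. norm_bound (?B ^\<^sub>m k) b"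
      using spectral_radius_jnf_norm_bound_less_1_upper_triangular[OF B
          spectral_radius_smult_less_1[OF A n c(1) c0]] by blast
    define M where "M = real n * (b * (\<Sum>j<n. cmod (v $ j)))"
    have bound: "(q / c) ^ k * vec_norm2 v \<le> M" for k
    proof -
      have "(q / c) ^ k * vec_norm2 v \<le> (1 / c) ^ k * vec_norm2 (A ^\<^sub>m k *\<^sub>v v)"
        using mult_left_mono[OF normal_vec_norm2_pow_ge[OF A normal v q(2) eq_refl[OF q(1)], of k],
            of "(1 / c) ^ k"] c0
        by (simp add: power_divide)
      also have "\<dots> = vec_norm2 (?B ^\<^sub>m k *\<^sub>v v)"
        using c0 by (simp only: pow_smult_mat_mult_vec[OF A v] vec_norm2_smult)
          (simp add: norm_power norm_divide)
      also have "\<dots> \<le> M"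
        unfolding M_def by (rule norm_bound_vec_norm2[OF pow_carrier_mat[OF B] b v])
      finally show ?thesis .
    qed
    have "1 < q / c" using c c0 by simp
    then obtain k where "M / vec_norm2 v < (q / c) ^ k"
      using real_arch_pow by blast
    thus False using bound[of k] pos by (simp add: divide_less_eq)
  qed
  thus ?thesis using q(1) mult_right_mono[of q "spectral_radius A" "vec_norm2 v"] by simp
qed

corollary normal_cscalar_prod_le_spectral_radius:
  assumes A: "A \<in> carrier_mat n n" and normal: "mat_adjoint A * A = A * mat_adjoint A"
    and v: "v \<in> carrier_vec n" and w: "w \<in> carrier_vec n" and n: "0 < n"
  shows "cmod ((A *\<^sub>v v) \<bullet>c w) \<le> spectral_radius A * (vec_norm2 v * vec_norm2 w)"
proof -
  have "cmod ((A *\<^sub>v v) \<bullet>c w) \<le> vec_norm2 (A *\<^sub>v v) * vec_norm2 w"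
    using A w by (intro cmod_cscalar_prod_le) auto
  also have "\<dots> \<le> spectral_radius A * vec_norm2 v * vec_norm2 w"
    by (intro mult_right_mono normal_vec_norm2_le_spectral_radius[OF A normal v n]) simp
  finally show ?thesis by (simp add: mult_ac)
qed

section \<open>The skew adjacency matrix\<close>

lemma skew_adjacency_matrix_carrier [simp]:
  "skew_adjacency_matrix vs D \<in> carrier_mat (length vs) (length vs)"
  by (simp add: skew_adjacency_matrix_def)

lemma dim_skew_adjacency_matrix [simp]:
  "dim_row (skew_adjacency_matrix vs D) = length vs"
  "dim_col (skew_adjacency_matrix vs D) = length vs"
  by (simp_all add: skew_adjacency_matrix_def)

text \<open>An arc of \<open>D\<close> is an arc of \<open>G\<close>, and exactly one direction of
  it survives. The case \<open>u = v\<close> excludes loops, so the diagonal of the skew adjacency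
  matrix is zero.\<close>

lemma orientation_of_antisym:
  assumes "orientation_of D G" "(u, v) \<in> parcs D"
  shows "(v, u) \<notin> parcs D"
  using assms unfolding orientation_of_def by blast

text \<open>By antisymmetry the nested conditional becomes a difference, which later splits into the
  two arc counts.\<close>

lemma skew_adjacency_matrix_index:
  assumes "orientation_of D G" "i < length vs" "j < length vs"
  shows "skew_adjacency_matrix vs D $$ (i, j) =
    of_bool ((vs ! i, vs ! j) \<in> parcs D) - of_bool ((vs ! j, vs ! i) \<in> parcs D)"
  using assms by (auto simp: skew_adjacency_matrix_def dest: orientation_of_antisym)

text \<open>The entries are real, so conjugation has no effect, and exchanging the indices changes
  the sign.\<close>

lemma skew_adjacency_matrix_adjoint:
  assumes "orientation_of D G"
  shows "mat_adjoint (skew_adjacency_matrix vs D) = - skew_adjacency_matrix vs D"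
  by (intro eq_matI)
    (auto simp: mat_adjoint_index[of _ "length vs"] skew_adjacency_matrix_index[OF assms])

lemma skew_adjacency_matrix_normal:
  fixes vs :: "'a list" and D :: "'a pair_pre_digraph"
  defines "S \<equiv> skew_adjacency_matrix vs D"
  assumes "orientation_of D G"
  shows "mat_adjoint S * S = S * mat_adjoint S"
  by (simp add: S_def skew_adjacency_matrix_adjoint[OF assms(2)])

section \<open>Arc counts as sums over vertices and as inner products\<close>

lemma arcs_between_eq_sum:
  assumes "finite V" "A \<subseteq> V" "B \<subseteq> V"
  shows "arcs_between D A B = (\<Sum>u\<in>V. \<Sum>v\<in>V. of_bool (u \<in> A \<and> v \<in> B \<and> (u, v) \<in> parcs D))"
proof -
  have "arcs_between D A B = card ((V \<times> V) \<inter> {(u, v). u \<in> A \<and> v \<in> B \<and> (u, v) \<in> parcs D})"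
    unfolding arcs_between_def using assms by (intro arg_cong[where f = card]) auto
  also have "\<dots> = (\<Sum>(u, v)\<in>V \<times> V. of_bool (u \<in> A \<and> v \<in> B \<and> (u, v) \<in> parcs D))"
    using assms(1) by (simp add: case_prod_unfold sum_of_bool_eq)
  finally show ?thesis by (simp add: sum.cartesian_product)
qed

lemma sum_nth_distinct: "distinct xs \<Longrightarrow> (\<Sum>i<length xs. f (xs ! i)) = sum f (set xs)"
  by (rule sum.reindex_bij_betw[OF bij_betw_nth]) auto

lemma vec_norm2_indicator_nth:
  assumes "distinct vs" "A \<subseteq> set vs"
  shows "vec_norm2 (vec (length vs) (\<lambda>i. of_bool (vs ! i \<in> A))) = sqrt (card A)"
proof -
  have "bij_betw ((!) vs) {i. i < length vs \<and> vs ! i \<in> A} A"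
    using assms
    by (auto simp: bij_betw_def inj_on_def nth_eq_iff_index_eq in_set_conv_nth image_iff subset_iff)
  thus ?thesis by (simp add: vec_norm2_indicator bij_betw_same_card)
qed

text \<open>Rows are selected by \<open>A\<close> and columns by \<open>B\<close>, so the entries 1
  count arcs from \<open>A\<close> to \<open>B\<close> and the entries -1 count arcs from
  \<open>B\<close> to \<open>A\<close>.\<close>

lemma skew_adjacency_matrix_indicator_prod:
  fixes D :: "'a pair_pre_digraph" and vs :: "'a list"
  defines "ind A \<equiv> vec (length vs) (\<lambda>i. of_bool (vs ! i \<in> A))"
  assumes D: "orientation_of D G" and vs: "distinct vs" "A \<subseteq> set vs" "B \<subseteq> set vs"
  shows "(skew_adjacency_matrix vs D *\<^sub>v ind B) \<bullet>c ind A =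
    of_nat (arcs_between D A B) - of_nat (arcs_between D B A)"
proof -
  let ?n = "length vs" and ?S = "skew_adjacency_matrix vs D" and ?V = "set vs"
  have ind: "ind A \<in> carrier_vec ?n" for A by (simp add: ind_def)
  have ind_index: "ind A $ i = of_bool (vs ! i \<in> A)" if "i < ?n" for A i
    using that by (simp add: ind_def)
  let ?f = "\<lambda>u v. of_bool (u \<in> A \<and> v \<in> B \<and> (u, v) \<in> parcs D) -
    (of_bool (v \<in> B \<and> u \<in> A \<and> (v, u) \<in> parcs D) :: complex)"
  have "(?S *\<^sub>v ind B) \<bullet>c ind A = (\<Sum>i<?n. (?S *\<^sub>v ind B) $ i * cnj (ind A $ i))"
    using ind[of A] by (simp add: scalar_prod_def atLeast0LessThan del: index_mult_mat_vec)
  also have "\<dots> = (\<Sum>i<?n. \<Sum>j<?n. ?f (vs ! i) (vs ! j))"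
  proof (intro sum.cong refl)
    fix i assume "i \<in> {..<?n}"
    hence i: "i < ?n" by simp
    show "(?S *\<^sub>v ind B) $ i * cnj (ind A $ i) = (\<Sum>j<?n. ?f (vs ! i) (vs ! j))"
      unfolding mult_mat_vec_index[OF skew_adjacency_matrix_carrier ind i] sum_distrib_right
    proof (intro sum.cong refl)
      fix j assume "j \<in> {..<?n}"
      thus "?S $$ (i, j) * ind B $ j * cnj (ind A $ i) = ?f (vs ! i) (vs ! j)"
        using i by (cases "vs ! i \<in> A"; cases "vs ! j \<in> B")
          (simp_all add: skew_adjacency_matrix_index[OF D] ind_index)
    qed
  qed
  also have "\<dots> = (\<Sum>u\<in>?V. \<Sum>v\<in>?V. ?f u v)"
    by (simp only: sum_nth_distinct[OF vs(1), of "\<lambda>v. ?f u v" for u]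
        sum_nth_distinct[OF vs(1), of "\<lambda>u. \<Sum>v\<in>?V. ?f u v"])
  \<comment> \<open>Swapping the order in the subtracted sum puts the tail \<open>v\<close> outside,
    the form that \<open>arcs_between_eq_sum\<close> gives for
    \<open>arcs_between D B A\<close>.\<close>
  also have "\<dots> = (\<Sum>u\<in>?V. \<Sum>v\<in>?V. of_bool (u \<in> A \<and> v \<in> B \<and> (u, v) \<in> parcs D)) -
      (\<Sum>v\<in>?V. \<Sum>u\<in>?V. of_bool (v \<in> B \<and> u \<in> A \<and> (v, u) \<in> parcs D))"
    unfolding sum_subtractf by (intro arg_cong2[where f = "(-)"] refl sum.swap)
  finally show ?thesis
    using vs by (simp add: arcs_between_eq_sum[of ?V])
qed

theorem theorem2p1:
  fixes G D :: "'a pair_pre_digraph" and vs :: "'a list" and A B :: "'a set"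
  assumes "pair_graph G"
    and "orientation_of D G"
    and "distinct vs" and "set vs = pverts G"
    and "A \<subseteq> pverts G" and "A \<noteq> {}"
    and "B \<subseteq> pverts G" and "B \<noteq> {}"
  shows "skew_spectral_radius vs D \<ge>
    \<bar>real (arcs_between D A B) - real (arcs_between D B A)\<bar> / sqrt (real (card A) * real (card B))"
proof -
  let ?S = "skew_adjacency_matrix vs D"
  let ?ind = "\<lambda>A. vec (length vs) (\<lambda>i. of_bool (vs ! i \<in> A))"
  have sub: "A \<subseteq> set vs" "B \<subseteq> set vs" using assms by auto
  have card: "0 < card A" "0 < card B"
    using assms(6,8) finite_subset[OF sub(1)] finite_subset[OF sub(2)] by (auto simp: card_gt_0_iff)
  \<comment> \<open>Positive dimension makes the spectrum nonempty, so that the spectral radius is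
    an attained maximum.\<close>
  have n: "0 < length vs" using sub(1) assms(6) by auto
  have "\<bar>real (arcs_between D A B) - real (arcs_between D B A)\<bar> =
      cmod (of_real (real (arcs_between D A B) - real (arcs_between D B A)))"
    by (simp only: norm_of_real)
  also have "\<dots> = cmod ((?S *\<^sub>v ?ind B) \<bullet>c ?ind A)"
    by (simp add: skew_adjacency_matrix_indicator_prod[OF assms(2,3) sub])
  also have "\<dots> \<le> spectral_radius ?S * (vec_norm2 (?ind B) * vec_norm2 (?ind A))"
    using n by (intro normal_cscalar_prod_le_spectral_radius[of _ "length vs"]
        skew_adjacency_matrix_normal[OF assms(2)]) auto
  also have "\<dots> = skew_spectral_radius vs D * sqrt (real (card A) * real (card B))"
    by (simp add: vec_norm2_indicator_nth[OF assms(3)] sub skew_spectral_radius_def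
        real_sqrt_mult mult_ac)
  finally show ?thesis
    using card by (simp add: divide_le_eq)
qed

end
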